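(* Let $q$ be a prime power and let $m\ge 1$ be an integer. For each integer $n\ge 1$ let $U=\mathbb{F}_q^n$, $W=\mathbb{F}_q^m$, let $\mathcal{F}$ be the set of all functions $U\to W$, and let $\Gamma$ be the extended-affine group acting on $\mathcal{F}$. Let $F,G\in\mathcal{F}$ be independent and uniformly random. Then, as $n\to\infty$ (with $q$ and $m$ fixed), the probability that $F$ and $G$ are EA-equivalent satisfies $$\mathbb{P}(F\sim_{\mathrm{EA}}G)=\frac{|\Gamma|}{|\mathcal{F}|}\,(1+o(1)).$$
   Context: For $V=\mathbb{F}_q^k$, $\mathrm{AGL}(V)$ is the group of affine permutations $x\mapsto Px+a$ with $P\in \mathrm{GL}(k,q)$, $a\in V$; $\mathrm{Hom}(U,W)$ is the space of $\mathbb{F}_q$-linear maps $U\to W$. The extended-affine (EA) group $\Gamma$ has underlying set $\mathrm{AGL}(U)\times\mathrm{AGL}(W)\times\mathrm{Hom}(U,W)$. An element $g=(A_{\rm in},A_{\rm out},L)$, with $A_{\rm in}(x)=Px+a$ and $A_{\rm out}(y)=Qy+b$, acts on $F\in\mathcal{F}$ by $$(g\cdot F)(x)=A_{\rm out}\bigl(F(A_{\rm in}(x))\bigr)+L(x)=Q\,F(Px+a)+Lx+b ,$$ the group law on $\Gamma$ being the one given by composition of these transformations, so that this is a group action. $F\sim_{\mathrm{EA}}G$ (EA-equivalence) means that $F$ and $G$ lie in the same $\Gamma$-orbit. One has $|\Gamma|=|\mathrm{AGL}(U)|\cdot|\mathrm{AGL}(W)|\cdot q^{nm}$ and $|\mathcal{F}|=q^{mq^n}$.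 *)

theory Defs
  imports
    "HOL-Probability.Probability_Mass_Function"
    "HOL-Library.Landau_Symbols"
    "HOL-Algebra.Group_Action"
    "Jordan_Normal_Form.Matrix"
begin

text \<open>
  The space of column vectors of length \<open>k\<close> over a field \<open>'q\<close> is \<open>carrier_vec k\<close>, so that the
  dimension is an ordinary natural number. All maps between such spaces are extensional, i.e.
  equal to \<open>undefined\<close> outside their domain: equality of maps is then equality on the domain,
  and the cardinality of a set of maps is the expected one.
\<close>

definition vec_funs :: "nat \<Rightarrow> nat \<Rightarrow> ('q vec \<Rightarrow> 'q vec) set" where
  "vec_funs n m = carrier_vec n \<rightarrow>\<^sub>E carrier_vec m"

definition GL :: "nat \<Rightarrow> 'q :: field mat set" where
  "GL k = {P \<in> carrier_mat k k. invertible_mat P}"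

definition affine_map :: "nat \<Rightarrow> 'q :: field mat \<Rightarrow> 'q vec \<Rightarrow> 'q vec \<Rightarrow> 'q vec" where
  "affine_map k P a = (\<lambda>x\<in>carrier_vec k. P *\<^sub>v x + a)"

definition AGL :: "nat \<Rightarrow> ('q :: field vec \<Rightarrow> 'q vec) set" where
  "AGL k = {affine_map k P a | P a. P \<in> GL k \<and> a \<in> carrier_vec k}"

definition Lin :: "nat \<Rightarrow> nat \<Rightarrow> ('q :: field vec \<Rightarrow> 'q vec) set" where
  "Lin n m = {L \<in> vec_funs n m.
     (\<forall>x\<in>carrier_vec n. \<forall>y\<in>carrier_vec n. L (x + y) = L x + L y) \<and>
     (\<forall>c. \<forall>x\<in>carrier_vec n. L (c \<cdot>\<^sub>v x) = c \<cdot>\<^sub>v L x)}"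

type_synonym 'q ea = "('q vec \<Rightarrow> 'q vec) \<times> ('q vec \<Rightarrow> 'q vec) \<times> ('q vec \<Rightarrow> 'q vec)"

text \<open>
  With \<open>A\<^sub>i\<^sub>n x = P x + a\<close> and \<open>A\<^sub>o\<^sub>u\<^sub>t y = Q y + b\<close>, acting with
  \<open>(A\<^sub>i\<^sub>n, A\<^sub>o\<^sub>u\<^sub>t, L)\<close> after \<open>(A\<^sub>i\<^sub>n', A\<^sub>o\<^sub>u\<^sub>t', L')\<close> sends \<open>F\<close> to
  \<open>x \<mapsto> A\<^sub>o\<^sub>u\<^sub>t (A\<^sub>o\<^sub>u\<^sub>t' (F (A\<^sub>i\<^sub>n' (A\<^sub>i\<^sub>n x))) + L' (A\<^sub>i\<^sub>n x)) + L x\<close>. Here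
  \<open>L' (A\<^sub>i\<^sub>n x) = L' (P x) + L' a\<close>, so the constant \<open>Q (L' a)\<close> goes to the outer affine part
  (note \<open>a = A\<^sub>i\<^sub>n 0\<close>) and \<open>Q (L' (P x)) = A\<^sub>o\<^sub>u\<^sub>t (L' (A\<^sub>i\<^sub>n x)) - A\<^sub>o\<^sub>u\<^sub>t (L' (A\<^sub>i\<^sub>n 0))\<close> to the
  linear part; see \<open>ea_mult_affine\<close>. The theorems \<open>group_EA_group\<close> and
  \<open>group_action_ea_act\<close> confirm that this is a group acting on the set of functions.
\<close>

definition ea_mult :: "nat \<Rightarrow> nat \<Rightarrow> 'q :: field ea \<Rightarrow> 'q ea \<Rightarrow> 'q ea" where
  "ea_mult n m = (\<lambda>(A_in, A_out, L) (A_in', A_out', L').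
     (\<lambda>x\<in>carrier_vec n. A_in' (A_in x),
      \<lambda>y\<in>carrier_vec m. A_out (A_out' y + L' (A_in (0\<^sub>v n))),
      \<lambda>x\<in>carrier_vec n. A_out (L' (A_in x)) - A_out (L' (A_in (0\<^sub>v n))) + L x))"

definition EA_group :: "nat \<Rightarrow> nat \<Rightarrow> 'q :: field ea monoid" where
  "EA_group n m =
     \<lparr>carrier = AGL n \<times> AGL m \<times> Lin n m,
      mult = ea_mult n m,
      one = (\<lambda>x\<in>carrier_vec n. x, \<lambda>y\<in>carrier_vec m. y, \<lambda>x\<in>carrier_vec n. 0\<^sub>v m)\<rparr>"

definition ea_act :: "nat \<Rightarrow> nat \<Rightarrow> 'q :: field ea \<Rightarrow> ('q vec \<Rightarrow> 'q vec) \<Rightarrow> 'q vec \<Rightarrow> 'q vec" where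
  "ea_act n m = (\<lambda>(A_in, A_out, L). \<lambda>F\<in>vec_funs n m. \<lambda>x\<in>carrier_vec n. A_out (F (A_in x)) + L x)"

definition EA_equivalent ::
    "nat \<Rightarrow> nat \<Rightarrow> ('q :: field vec \<Rightarrow> 'q vec) \<Rightarrow> ('q vec \<Rightarrow> 'q vec) \<Rightarrow> bool" where
  "EA_equivalent n m F G \<longleftrightarrow>
     (\<exists>orb \<in> orbits (EA_group n m) (vec_funs n m) (ea_act n m). F \<in> orb \<and> G \<in> orb)"

lemma GL_carrier: "P \<in> GL k \<Longrightarrow> P \<in> carrier_mat k k"
  by (simp add: GL_def)

lemma one_GL: "1\<^sub>m k \<in> GL k"
  by (auto simp: GL_def invertible_mat_def inverts_mat_def intro!: exI[of _ "1\<^sub>m k"])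

lemma GL_inverse:
  assumes "P \<in> GL k"
  obtains P' where "P' \<in> GL k" "P * P' = 1\<^sub>m k" "P' * P = 1\<^sub>m k"
proof -
  from assms obtain B where P: "P \<in> carrier_mat k k"
    and B: "P * B = 1\<^sub>m k" "B * P = 1\<^sub>m (dim_row B)"
    by (auto simp: GL_def invertible_mat_def inverts_mat_def)
  have "dim_col (P * B) = k" "dim_col (B * P) = dim_row B"
    by (simp_all only: B index_one_mat)
  with P have Bc: "B \<in> carrier_mat k k" by auto
  moreover from this have "B * P = 1\<^sub>m k" using B by simp
  moreover have "B \<in> GL k"
    using P Bc B by (auto simp: GL_def invertible_mat_def inverts_mat_def intro!: exI[of _ P])
  ultimately show ?thesis using that B(1) by blast
qed

lemma mult_GL:
  assumes "P \<in> GL k" "Q \<in> GL k"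
  shows "P * Q \<in> GL k"
proof -
  obtain P' where P': "P' \<in> GL k" "P * P' = 1\<^sub>m k" "P' * P = 1\<^sub>m k"
    using GL_inverse assms(1) .
  obtain Q' where Q': "Q' \<in> GL k" "Q * Q' = 1\<^sub>m k" "Q' * Q = 1\<^sub>m k"
    using GL_inverse assms(2) .
  note c = assms[THEN GL_carrier] P'(1)[THEN GL_carrier] Q'(1)[THEN GL_carrier]
  have "(P * Q) * (Q' * P') = P * ((Q * Q') * P')"
    using c by (simp add: assoc_mult_mat[where n\<^sub>1 = k and n\<^sub>2 = k and n\<^sub>3 = k and n\<^sub>4 = k])
  moreover have "(Q' * P') * (P * Q) = Q' * ((P' * P) * Q)"
    using c by (simp add: assoc_mult_mat[where n\<^sub>1 = k and n\<^sub>2 = k and n\<^sub>3 = k and n\<^sub>4 = k])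
  ultimately show ?thesis
    using c P' Q'
    by (auto simp: GL_def invertible_mat_def inverts_mat_def intro!: exI[of _ "Q' * P'"])
qed

lemma affine_map_eqI:
  assumes "P = P'" "a = a'"
  shows "affine_map k P a = affine_map k P' a'"
  using assms by simp

lemma restrict_id_affine_map: "(\<lambda>x\<in>carrier_vec k. x) = affine_map k (1\<^sub>m k) (0\<^sub>v k)"
  by (auto simp: affine_map_def)

lemma LinD:
  assumes "L \<in> Lin n m" "x \<in> carrier_vec n"
  shows "L x \<in> carrier_vec m"
    and "y \<in> carrier_vec n \<Longrightarrow> L (x + y) = L x + L y"
    and "L (c \<cdot>\<^sub>v x) = c \<cdot>\<^sub>v L x"
    and "L (0\<^sub>v n) = 0\<^sub>v m"
proof -
  show Lx: "L x \<in> carrier_vec m"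
    using assms by (auto simp: Lin_def vec_funs_def)
  show "y \<in> carrier_vec n \<Longrightarrow> L (x + y) = L x + L y"
    using assms by (auto simp: Lin_def)
  have smult: "L (c \<cdot>\<^sub>v x) = c \<cdot>\<^sub>v L x" for c
    using assms by (auto simp: Lin_def)
  then show "L (c \<cdot>\<^sub>v x) = c \<cdot>\<^sub>v L x" .
  have "0 \<cdot>\<^sub>v x = 0\<^sub>v n" "0 \<cdot>\<^sub>v L x = 0\<^sub>v m"
    using assms(2) Lx by (auto intro!: eq_vecI)
  with smult[of 0] show "L (0\<^sub>v n) = 0\<^sub>v m" by simp
qed

lemma Lin_transform:
  assumes "L \<in> Lin n m" "L' \<in> Lin n m" "P \<in> carrier_mat n n" "Q \<in> carrier_mat m m"
  shows "(\<lambda>x\<in>carrier_vec n. Q *\<^sub>v L' (P *\<^sub>v x) + L x) \<in> Lin n m"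
proof -
  note c = assms(3,4)
  have 1: "Q *\<^sub>v L' (P *\<^sub>v x) + L x \<in> carrier_vec m" if "x \<in> carrier_vec n" for x
    using that c LinD(1)[OF assms(1)] LinD(1)[OF assms(2)] by auto
  have 2: "Q *\<^sub>v L' (P *\<^sub>v (x + y)) + L (x + y) =
      Q *\<^sub>v L' (P *\<^sub>v x) + L x + (Q *\<^sub>v L' (P *\<^sub>v y) + L y)"
    if "x \<in> carrier_vec n" "y \<in> carrier_vec n" for x y
  proof -
    have d: "P *\<^sub>v x \<in> carrier_vec n" "P *\<^sub>v y \<in> carrier_vec n" using c that by auto
    note e = LinD(1)[OF assms(2) d(1)] LinD(1)[OF assms(2) d(2)]
      LinD(1)[OF assms(1) that(1)] LinD(1)[OF assms(1) that(2)]
    have "Q *\<^sub>v L' (P *\<^sub>v (x + y)) + L (x + y)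
        = (Q *\<^sub>v L' (P *\<^sub>v x) + Q *\<^sub>v L' (P *\<^sub>v y)) + (L x + L y)"
      using that d e LinD(2)[OF assms(1) that] LinD(2)[OF assms(2) d]
      by (simp add: mult_add_distrib_mat_vec[OF assms(3)] mult_add_distrib_mat_vec[OF assms(4)])
    also have "\<dots> = Q *\<^sub>v L' (P *\<^sub>v x) + L x + (Q *\<^sub>v L' (P *\<^sub>v y) + L y)"
      using e c by (intro eq_vecI) auto
    finally show ?thesis .
  qed
  have 3: "Q *\<^sub>v L' (P *\<^sub>v (k \<cdot>\<^sub>v x)) + L (k \<cdot>\<^sub>v x) = k \<cdot>\<^sub>v (Q *\<^sub>v L' (P *\<^sub>v x) + L x)"
    if "x \<in> carrier_vec n" for x k
  proof -
    have d: "P *\<^sub>v x \<in> carrier_vec n" using c that by auto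
    note e = LinD(1)[OF assms(2) d(1)] LinD(1)[OF assms(1) that(1)]
    show ?thesis
      using that d e c LinD(3)[OF assms(1) that] LinD(3)[OF assms(2) d]
      by (simp add: mult_mat_vec[OF assms(3)] mult_mat_vec[OF assms(4)]
          smult_add_distrib_vec[where n = m])
  qed
  show ?thesis using 1 2 3 by (auto simp: Lin_def vec_funs_def)
qed

lemma EA_carrierE:
  assumes "g \<in> carrier (EA_group n m)"
  obtains P a Q b L where "g = (affine_map n P a, affine_map m Q b, L)"
    "P \<in> GL n" "P \<in> carrier_mat n n" "a \<in> carrier_vec n"
    "Q \<in> GL m" "Q \<in> carrier_mat m m" "b \<in> carrier_vec m" "L \<in> Lin n m"
  using assms by (auto simp: EA_group_def AGL_def GL_carrier)

lemma EA_carrierI: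
  assumes "P \<in> GL n" "a \<in> carrier_vec n" "Q \<in> GL m" "b \<in> carrier_vec m" "L \<in> Lin n m"
  shows "(affine_map n P a, affine_map m Q b, L) \<in> carrier (EA_group n m)"
  using assms by (auto simp: EA_group_def AGL_def)

lemma ea_mult_affine:
  assumes "P \<in> carrier_mat n n" "a \<in> carrier_vec n" "Q \<in> carrier_mat m m" "b \<in> carrier_vec m"
    and "P' \<in> carrier_mat n n" "a' \<in> carrier_vec n" "Q' \<in> carrier_mat m m" "b' \<in> carrier_vec m"
    and "L' \<in> Lin n m"
  shows "ea_mult n m (affine_map n P a, affine_map m Q b, L)
            (affine_map n P' a', affine_map m Q' b', L') =
         (affine_map n (P' * P) (P' *\<^sub>v a + a'),
          affine_map m (Q * Q') (Q *\<^sub>v b' + Q *\<^sub>v L' a + b),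
          \<lambda>x\<in>carrier_vec n. Q *\<^sub>v L' (P *\<^sub>v x) + L x)"
proof -
  note La = LinD(1)[OF assms(9,2)]
  have z: "P *\<^sub>v 0\<^sub>v n + a = a" using assms(1,2) by (intro eq_vecI) auto
  have 1: "P' *\<^sub>v (P *\<^sub>v x + a) + a' = P' * P *\<^sub>v x + (P' *\<^sub>v a + a')"
    if "x \<in> carrier_vec n" for x
  proof -
    have "P' *\<^sub>v (P *\<^sub>v x + a) = P' *\<^sub>v (P *\<^sub>v x) + P' *\<^sub>v a"
      using assms that by (intro mult_add_distrib_mat_vec[of _ n n]) auto
    moreover have "P' * P *\<^sub>v x = P' *\<^sub>v (P *\<^sub>v x)"
      using assms that by (intro assoc_mult_mat_vec[of _ n n _ n]) auto
    ultimately show ?thesis using assms that by (simp add: assoc_add_vec[where n = n])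
  qed
  have 2: "Q *\<^sub>v (Q' *\<^sub>v y + b' + L' a) + b = Q * Q' *\<^sub>v y + (Q *\<^sub>v b' + Q *\<^sub>v L' a + b)"
    if "y \<in> carrier_vec m" for y
  proof -
    have "Q *\<^sub>v (Q' *\<^sub>v y + b' + L' a) = Q *\<^sub>v (Q' *\<^sub>v y + b') + Q *\<^sub>v L' a"
      using assms that La by (intro mult_add_distrib_mat_vec[of _ m m]) auto
    also have "Q *\<^sub>v (Q' *\<^sub>v y + b') = Q *\<^sub>v (Q' *\<^sub>v y) + Q *\<^sub>v b'"
      using assms that La by (intro mult_add_distrib_mat_vec[of _ m m]) auto
    also have "Q *\<^sub>v (Q' *\<^sub>v y) = Q * Q' *\<^sub>v y"
      using assms that by (intro assoc_mult_mat_vec[of _ m m _ m, symmetric]) auto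
    finally show ?thesis using assms that La by (intro eq_vecI) auto
  qed
  have 3: "(Q *\<^sub>v L' (P *\<^sub>v x + a) + b) - (Q *\<^sub>v L' a + b) + L x = Q *\<^sub>v L' (P *\<^sub>v x) + L x"
    if "x \<in> carrier_vec n" for x
  proof -
    have d: "P *\<^sub>v x \<in> carrier_vec n" using assms that by auto
    note LP = LinD(1)[OF assms(9) d]
    have "Q *\<^sub>v L' (P *\<^sub>v x + a) = Q *\<^sub>v L' (P *\<^sub>v x) + Q *\<^sub>v L' a"
      using assms that La LP LinD(2)[OF assms(9) d assms(2)]
      by (simp add: mult_add_distrib_mat_vec[of _ m m])
    moreover have "Q *\<^sub>v L' (P *\<^sub>v x) + Q *\<^sub>v L' a + b - (Q *\<^sub>v L' a + b) = Q *\<^sub>v L' (P *\<^sub>v x)"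
      using assms La LP by (intro eq_vecI) auto
    ultimately show ?thesis by simp
  qed
  have c: "P *\<^sub>v x + a \<in> carrier_vec n" "L' (P *\<^sub>v x + a) \<in> carrier_vec m"
    if "x \<in> carrier_vec n" for x
    using assms that LinD(1)[OF assms(9), of "P *\<^sub>v x + a"] by auto
  have d: "Q' *\<^sub>v y + b' + L' a \<in> carrier_vec m" if "y \<in> carrier_vec m" for y
    using assms that La by auto
  show ?thesis
    using c d La by (auto simp: ea_mult_def affine_map_def fun_eq_iff z 1 2 3)
qed

lemma EA_group_sel [simp]:
  "x \<otimes>\<^bsub>EA_group n m\<^esub> y = ea_mult n m x y"
  "\<one>\<^bsub>EA_group n m\<^esub> =
     (affine_map n (1\<^sub>m n) (0\<^sub>v n), affine_map m (1\<^sub>m m) (0\<^sub>v m), \<lambda>x\<in>carrier_vec n. 0\<^sub>v m)"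
  by (simp_all add: EA_group_def restrict_id_affine_map)

lemma zero_Lin: "(\<lambda>x\<in>carrier_vec n. 0\<^sub>v m) \<in> Lin n m"
  by (auto simp: Lin_def vec_funs_def)

lemma ea_mult_closed:
  assumes "g \<in> carrier (EA_group n m)" "h \<in> carrier (EA_group n m)"
  shows "ea_mult n m g h \<in> carrier (EA_group n m)"
  using assms
proof (elim EA_carrierE, goal_cases)
  case (1 P a Q b L P' a' Q' b' L')
  then show ?case
    using LinD(1)[of L' n m a] Lin_transform[of L n m L' P Q]
    by (auto simp: ea_mult_affine intro!: mult_GL EA_carrierI)
qed

lemma ea_mult_assoc:
  fixes g h k :: "'q :: field ea"
  assumes "g \<in> carrier (EA_group n m)" "h \<in> carrier (EA_group n m)" "k \<in> carrier (EA_group n m)"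
  shows "ea_mult n m (ea_mult n m g h) k = ea_mult n m g (ea_mult n m h k)"
  using assms
proof (elim EA_carrierE, goal_cases)
  case (1 P a Q b L P' a' Q' b' L' P'' a'' Q'' b'' L'')
  note distr = mult_add_distrib_mat_vec[where nr = n and nc = n]
    mult_add_distrib_mat_vec[where nr = m and nc = m]
  note assoc = assoc_mult_mat_vec[where n\<^sub>1 = n and n\<^sub>2 = n and n\<^sub>3 = n]
    assoc_mult_mat_vec[where n\<^sub>1 = m and n\<^sub>2 = m and n\<^sub>3 = m]
    assoc_mult_mat[where n\<^sub>1 = n and n\<^sub>2 = n and n\<^sub>3 = n and n\<^sub>4 = n]
    assoc_mult_mat[where n\<^sub>1 = m and n\<^sub>2 = m and n\<^sub>3 = m and n\<^sub>4 = m]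
  note cn = 1(3,4,11,12,19,20) and cm = 1(6,7,14,15,22,23)
  have cmm: "A *\<^sub>v x \<in> carrier_vec d" if "A \<in> carrier_mat d d" "x \<in> carrier_vec d"
    for A :: "'q mat" and x d using that by auto
  have L': "L' x \<in> carrier_vec m" and L'': "L'' x \<in> carrier_vec m" and L: "L x \<in> carrier_vec m"
    if "x \<in> carrier_vec n" for x
    using LinD(1) 1 that by auto
  have L''_add: "L'' (x + y) = L'' x + L'' y" if "x \<in> carrier_vec n" "y \<in> carrier_vec n" for x y
    using LinD(2)[OF 1(24)] that .
  have M: "(\<lambda>x\<in>carrier_vec n. Q *\<^sub>v L' (P *\<^sub>v x) + L x) \<in> Lin n m"
    and N: "(\<lambda>x\<in>carrier_vec n. Q' *\<^sub>v L'' (P' *\<^sub>v x) + L' x) \<in> Lin n m"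
    using 1 by (auto intro!: Lin_transform)
  have "affine_map n (P'' * (P' * P)) (P'' *\<^sub>v (P' *\<^sub>v a + a') + a'') =
        affine_map n (P'' * P' * P) (P'' * P' *\<^sub>v a + (P'' *\<^sub>v a' + a''))"
    using cn by (intro affine_map_eqI) (auto simp: distr assoc cmm)
  moreover have "affine_map m (Q * Q' * Q'')
      (Q * Q' *\<^sub>v b'' + Q * Q' *\<^sub>v L'' (P' *\<^sub>v a + a') + (Q *\<^sub>v b' + Q *\<^sub>v L' a + b)) =
    affine_map m (Q * (Q' * Q''))
      (Q *\<^sub>v (Q' *\<^sub>v b'' + Q' *\<^sub>v L'' a' + b') + Q *\<^sub>v (Q' *\<^sub>v L'' (P' *\<^sub>v a) + L' a) + b)"
  proof (intro affine_map_eqI)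
    show "Q * Q' *\<^sub>v b'' + Q * Q' *\<^sub>v L'' (P' *\<^sub>v a + a') + (Q *\<^sub>v b' + Q *\<^sub>v L' a + b) =
      Q *\<^sub>v (Q' *\<^sub>v b'' + Q' *\<^sub>v L'' a' + b') + Q *\<^sub>v (Q' *\<^sub>v L'' (P' *\<^sub>v a) + L' a) + b"
      using cn cm by (simp add: distr assoc cmm L' L'' L''_add)
        (intro eq_vecI, auto simp: cmm carrier_vecD[OF L'] carrier_vecD[OF L''])
  qed (use cm in \<open>simp add: assoc\<close>)
  moreover have "(\<lambda>x\<in>carrier_vec n. Q * Q' *\<^sub>v L'' (P' * P *\<^sub>v x) + (Q *\<^sub>v L' (P *\<^sub>v x) + L x)) =
      (\<lambda>x\<in>carrier_vec n. Q *\<^sub>v (Q' *\<^sub>v L'' (P' *\<^sub>v (P *\<^sub>v x)) + L' (P *\<^sub>v x)) + L x)"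
    using cn cm by (intro restrict_ext)
      (simp add: distr assoc cmm L L' L'' assoc_add_vec[where n = m])
  ultimately show ?case
    using cn cm 1 M N L L' L''
    by (simp add: ea_mult_affine cmm cong: restrict_cong)
qed

lemma ea_mult_one_left:
  assumes "g \<in> carrier (EA_group n m)"
  shows "ea_mult n m \<one>\<^bsub>EA_group n m\<^esub> g = g"
  using assms
proof (elim EA_carrierE, goal_cases)
  case (1 P a Q b L)
  have "(\<lambda>x\<in>carrier_vec n. 1\<^sub>m m *\<^sub>v L (1\<^sub>m n *\<^sub>v x) + (\<lambda>x\<in>carrier_vec n. 0\<^sub>v m) x) = L"
    (is "?lhs = L")
  proof
    fix x
    show "?lhs x = L x"
      using 1(8) LinD(1)[OF 1(8), of x]
      by (cases "x \<in> carrier_vec n") (auto simp: Lin_def vec_funs_def PiE_def extensional_def)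
  qed
  moreover have "P *\<^sub>v 0\<^sub>v n + a = a" "1\<^sub>m m *\<^sub>v b + 1\<^sub>m m *\<^sub>v L (0\<^sub>v n) + 0\<^sub>v m = b"
    using 1 LinD(4)[OF 1(8,4)] by (auto intro!: eq_vecI)
  ultimately show ?case
    unfolding 1(1) EA_group_sel(2) using 1 by (subst ea_mult_affine) simp_all
qed

lemma ea_mult_inverse_left:
  assumes "g \<in> carrier (EA_group n m)"
  shows "\<exists>h\<in>carrier (EA_group n m). ea_mult n m h g = \<one>\<^bsub>EA_group n m\<^esub>"
  using assms
proof (elim EA_carrierE, goal_cases)
  case (1 P a Q b L)
  obtain P' where P': "P' \<in> GL n" "P * P' = 1\<^sub>m n" "P' * P = 1\<^sub>m n" using GL_inverse 1(2) .
  obtain Q' where Q': "Q' \<in> GL m" "Q * Q' = 1\<^sub>m m" "Q' * Q = 1\<^sub>m m" using GL_inverse 1(5) .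
  define a' where "a' = P' *\<^sub>v (- a)"
  define b' where "b' = - (Q' *\<^sub>v b + Q' *\<^sub>v L a')"
  define L' where
    "L' = (\<lambda>x\<in>carrier_vec n. (- Q') *\<^sub>v L (P' *\<^sub>v x) + (\<lambda>x\<in>carrier_vec n. 0\<^sub>v m) x)"
  note c = P'(1)[THEN GL_carrier] Q'(1)[THEN GL_carrier]
  have a': "a' \<in> carrier_vec n" using c 1 by (auto simp: a'_def)
  note La' = LinD(1)[OF 1(8) a']
  have b': "b' \<in> carrier_vec m" using c 1 La' by (auto simp: b'_def)
  have L': "L' \<in> Lin n m"
    unfolding L'_def using c 1 by (intro Lin_transform zero_Lin) auto
  have "P *\<^sub>v a' = 1\<^sub>m n *\<^sub>v (- a)"
    using c 1 P' by (simp add: a'_def assoc_mult_mat_vec[where n\<^sub>1 = n and n\<^sub>2 = n and n\<^sub>3 = n, symmetric])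
  then have "P *\<^sub>v a' + a = 0\<^sub>v n" using 1 by (intro eq_vecI) auto
  moreover have "Q' *\<^sub>v b + Q' *\<^sub>v L a' + b' = 0\<^sub>v m"
    using c 1 La' by (intro eq_vecI) (auto simp: b'_def)
  moreover have "(\<lambda>x\<in>carrier_vec n. Q' *\<^sub>v L (P' *\<^sub>v x) + L' x) = (\<lambda>x\<in>carrier_vec n. 0\<^sub>v m)"
  proof (intro restrict_ext)
    fix x :: "'a vec" assume x: "x \<in> carrier_vec n"
    have "L (P' *\<^sub>v x) \<in> carrier_vec m" using x c LinD(1)[OF 1(8), of "P' *\<^sub>v x"] by auto
    with x c show "Q' *\<^sub>v L (P' *\<^sub>v x) + L' x = 0\<^sub>v m"
      by (intro eq_vecI) (auto simp: L'_def)
  qed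
  ultimately show ?case
    using c 1 a' b' L' P' Q'
    by (intro bexI[of _ "(affine_map n P' a', affine_map m Q' b', L')"])
      (auto simp: ea_mult_affine intro!: EA_carrierI)
qed

theorem group_EA_group: "group (EA_group n m)"
proof (rule groupI)
  show "\<one>\<^bsub>EA_group n m\<^esub> \<in> carrier (EA_group n m)"
    using EA_carrierI[OF one_GL _ one_GL _ zero_Lin, of "0\<^sub>v n" n "0\<^sub>v m" m] by simp
qed (simp_all only: EA_group_sel(1) ea_mult_closed ea_mult_assoc ea_mult_one_left
    ea_mult_inverse_left)

lemma ea_act_closed:
  assumes "g \<in> carrier (EA_group n m)" "F \<in> vec_funs n m"
  shows "ea_act n m g F \<in> vec_funs n m"
  using assms(1)
proof (elim EA_carrierE, goal_cases)
  case (1 P a Q b L)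
  have "F (P *\<^sub>v x + a) \<in> carrier_vec m" if "x \<in> carrier_vec n" for x
    using assms(2) 1 that by (auto simp: vec_funs_def)
  then show ?case
    using 1 assms(2) LinD(1)[OF 1(8)] by (auto simp: ea_act_def affine_map_def vec_funs_def)
qed

lemma ea_act_mult:
  assumes "g \<in> carrier (EA_group n m)" "h \<in> carrier (EA_group n m)" "F \<in> vec_funs n m"
  shows "ea_act n m (ea_mult n m g h) F = ea_act n m g (ea_act n m h F)"
proof -
  have closed: "ea_act n m h F \<in> vec_funs n m" using ea_act_closed assms by blast
  obtain P a Q b L where g: "g = (affine_map n P a, affine_map m Q b, L)"
    "P \<in> carrier_mat n n" "a \<in> carrier_vec n"
    "Q \<in> carrier_mat m m" "b \<in> carrier_vec m" "L \<in> Lin n m"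
    using assms(1) by (elim EA_carrierE)
  obtain P' a' Q' b' L' where h: "h = (affine_map n P' a', affine_map m Q' b', L')"
    "P' \<in> carrier_mat n n" "a' \<in> carrier_vec n"
    "Q' \<in> carrier_mat m m" "b' \<in> carrier_vec m" "L' \<in> Lin n m"
    using assms(2) by (elim EA_carrierE)
  note distr = mult_add_distrib_mat_vec[where nr = n and nc = n]
    mult_add_distrib_mat_vec[where nr = m and nc = m]
  note assoc = assoc_mult_mat_vec[where n\<^sub>1 = n and n\<^sub>2 = n and n\<^sub>3 = n]
    assoc_mult_mat_vec[where n\<^sub>1 = m and n\<^sub>2 = m and n\<^sub>3 = m]
  have cmm: "A *\<^sub>v x \<in> carrier_vec d" if "A \<in> carrier_mat d d" "x \<in> carrier_vec d"
    for A :: "'a mat" and x d using that by auto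
  have L: "L x \<in> carrier_vec m" and L': "L' x \<in> carrier_vec m"
    and Fc: "F x \<in> carrier_vec m" if "x \<in> carrier_vec n" for x
    using LinD(1) g h assms(3) that by (auto simp: vec_funs_def)
  have *: "Q * Q' *\<^sub>v F (P' * P *\<^sub>v x + (P' *\<^sub>v a + a')) + (Q *\<^sub>v b' + Q *\<^sub>v L' a + b)
        + (Q *\<^sub>v L' (P *\<^sub>v x) + L x)
      = Q *\<^sub>v (Q' *\<^sub>v F (P' *\<^sub>v (P *\<^sub>v x + a) + a') + b' + L' (P *\<^sub>v x + a)) + b + L x"
    if x: "x \<in> carrier_vec n" for x
  proof -
    define u where "u = P' *\<^sub>v (P *\<^sub>v x + a) + a'"
    have u: "u \<in> carrier_vec n" using g h x by (auto simp: u_def)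
    have "P' * P *\<^sub>v x + (P' *\<^sub>v a + a') = u"
      using g h x by (simp add: u_def distr assoc cmm assoc_add_vec[where n = n])
    moreover have "L' (P *\<^sub>v x + a) = L' (P *\<^sub>v x) + L' a"
      using LinD(2)[OF h(6)] g x by (simp add: cmm)
    ultimately show ?thesis
      unfolding u_def[symmetric] using g(2-) h(2-) x u
      by (simp add: distr assoc cmm L L' Fc)
        (intro eq_vecI, auto simp: cmm carrier_vecD[OF L])
  qed
  have "ea_act n m (ea_mult n m g h) F x = ea_act n m g (ea_act n m h F) x" for x
  proof (cases "x \<in> carrier_vec n")
    case True
    have c: "P *\<^sub>v x + a \<in> carrier_vec n" "P' * P *\<^sub>v x + (P' *\<^sub>v a + a') \<in> carrier_vec n"
      "P' *\<^sub>v (P *\<^sub>v x + a) + a' \<in> carrier_vec n"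
      using g h True by auto
    have d: "Q' *\<^sub>v F (P' *\<^sub>v (P *\<^sub>v x + a) + a') + b' + L' (P *\<^sub>v x + a) \<in> carrier_vec m"
      using h(2-) c L' Fc by (auto intro!: add_carrier_vec)
    show ?thesis
      using True c d *[OF True] g(2-) h(2-) assms(3) closed Fc
      by (simp add: g(1) h(1) ea_mult_affine) (simp add: ea_act_def affine_map_def)
  qed (use assms(3) closed in \<open>simp add: ea_act_def split: prod.split\<close>)
  then show ?thesis by blast
qed

lemma ea_act_one:
  assumes "F \<in> vec_funs n m"
  shows "ea_act n m \<one>\<^bsub>EA_group n m\<^esub> F = F"
proof
  fix x
  show "ea_act n m \<one>\<^bsub>EA_group n m\<^esub> F x = F x"
  proof (cases "x \<in> carrier_vec n")
    case True
    with assms have "F x \<in> carrier_vec m" by (auto simp: vec_funs_def)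
    with True assms show ?thesis by (simp add: ea_act_def affine_map_def)
  next
    case False
    with assms have "F x = undefined" by (auto simp: vec_funs_def)
    with False assms show ?thesis by (simp add: ea_act_def)
  qed
qed

theorem group_action_ea_act: "group_action (EA_group n m) (vec_funs n m) (ea_act n m)"
proof -
  interpret group "EA_group n m" by (rule group_EA_group)
  have Bij: "ea_act n m g \<in> Bij (vec_funs n m)" if g: "g \<in> carrier (EA_group n m)"
    for g :: "'a ea"
  proof -
    have inv: "inv\<^bsub>EA_group n m\<^esub> g \<in> carrier (EA_group n m)" using g by (rule inv_closed)
    have "bij_betw (ea_act n m g) (vec_funs n m) (vec_funs n m)"
    proof (rule bij_betw_byWitness[where f' = "ea_act n m (inv\<^bsub>EA_group n m\<^esub> g)"])
      show "\<forall>F\<in>vec_funs n m. ea_act n m (inv\<^bsub>EA_group n m\<^esub> g) (ea_act n m g F) = F"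
        using ea_act_mult[OF inv g] l_inv[OF g] ea_act_one by (metis EA_group_sel(1))
      show "\<forall>F\<in>vec_funs n m. ea_act n m g (ea_act n m (inv\<^bsub>EA_group n m\<^esub> g) F) = F"
        using ea_act_mult[OF g inv] r_inv[OF g] ea_act_one by (metis EA_group_sel(1))
    qed (use ea_act_closed g inv in blast)+
    moreover have "ea_act n m g \<in> extensional (vec_funs n m)"
      by (auto simp: ea_act_def split: prod.split)
    ultimately show ?thesis by (simp add: Bij_def)
  qed
  have "ea_act n m (ea_mult n m g h) = compose (vec_funs n m) (ea_act n m g) (ea_act n m h)"
    if "g \<in> carrier (EA_group n m)" "h \<in> carrier (EA_group n m)" for g h :: "'a ea"
  proof (rule extensionalityI[where A = "vec_funs n m"])
    show "ea_act n m (ea_mult n m g h) \<in> extensional (vec_funs n m)"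
      using Bij[OF ea_mult_closed[OF that]] by (rule Bij_imp_extensional)
  qed (auto simp: compose_def ea_act_mult that)
  with Bij show ?thesis
    by (intro group_action.intro group_hom.intro group_hom_axioms.intro homI
        group_EA_group group_BijGroup) (simp_all add: BijGroup_def)
qed

end

theory Submission
  imports
    Defs
    "HOL-Real_Asymp.Real_Asymp"
    "Berlekamp_Zassenhaus.Berlekamp_Type_Based"
begin

text \<open>
  By the orbit-stabilizer theorem the probability is \<open>|\<Gamma>| / |\<F>|\<close> times the mean of
  \<open>1 / |Stab F|\<close>, which lies between \<open>1 - \<Sum>\<^bsub>g \<noteq> 1\<^esub> |Fix g| / |\<F>|\<close> and \<open>1\<close>. A fixed-point equation
  \<open>F x = Q F(P x + a) + b + L x\<close> with \<open>g \<noteq> 1\<close> costs a factor exponential in \<open>q\<^sup>n\<close>. If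
  \<open>A\<^sub>i\<^sub>n\<close> is not the identity, it moves at least half of the points, hence maps some set \<open>S\<close> of
  at least \<open>q\<^sup>n / 6\<close> points off itself, and \<open>F\<close> is determined by its values outside
  \<open>S\<close>. If \<open>A\<^sub>i\<^sub>n\<close> is the identity, each value \<open>F x\<close> is a fixed point of a nontrivial affine
  map of \<open>W\<close>, so at most half of the values are possible. As \<open>|\<Gamma>|\<close> is only
  \<open>q\<close> to a quadratic polynomial in \<open>n\<close>, the sum over \<open>g\<close> tends to \<open>0\<close>.
\<close>

unbundle no vec_syntax

section \<open>Collision probability of orbits and the mean inverse stabilizer order\<close>

lemma pair_pmf_of_set:
  assumes "finite A" "A \<noteq> {}" "finite B" "B \<noteq> {}"
  shows "pair_pmf (pmf_of_set A) (pmf_of_set B) = pmf_of_set (A \<times> B)"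
proof (rule pmf_eqI)
  fix z
  show "pmf (pair_pmf (pmf_of_set A) (pmf_of_set B)) z = pmf (pmf_of_set (A \<times> B)) z"
    using assms by (cases z) (auto simp: pmf_pair indicator_def card_cartesian_product)
qed

context group_action
begin

text \<open>Used to slice the collision event by its first coordinate, each slice being a single
  orbit.\<close>

lemma same_orbit_iff:
  assumes "x \<in> E"
  shows "(\<exists>orb\<in>orbits G E \<phi>. x \<in> orb \<and> y \<in> orb) \<longleftrightarrow> y \<in> orbit G \<phi> x"
proof
  assume "\<exists>orb\<in>orbits G E \<phi>. x \<in> orb \<and> y \<in> orb"
  then obtain z where z: "z \<in> E" "x \<in> orbit G \<phi> z" "y \<in> orbit G \<phi> z"
    by (auto simp: orbits_def)
  then have "y \<in> E" using element_image by (auto simp: orbit_def)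
  with z assms show "y \<in> orbit G \<phi> x" by (meson orbit_sym orbit_trans)
next
  assume "y \<in> orbit G \<phi> x"
  then show "\<exists>orb\<in>orbits G E \<phi>. x \<in> orb \<and> y \<in> orb"
    using assms orbit_refl by (auto simp: orbits_def)
qed

lemma orbit_subset: "x \<in> E \<Longrightarrow> orbit G \<phi> x \<subseteq> E"
  using element_image by (auto simp: orbit_def)

text \<open>The event consists of the pairs with \<open>x\<close> in \<open>E\<close> and
  \<open>y\<close> in the orbit of \<open>x\<close>, and each orbit has size \<open>order G\<close>
  divided by the stabilizer order. Of the two factors \<open>card E\<close> in the denominator, one
  stays with \<open>order G\<close> and the other turns the sum into a mean.\<close>

lemma prob_same_orbit:
  assumes "finite E" "E \<noteq> {}" "finite (carrier G)"
  shows "measure_pmf.prob (pair_pmf (pmf_of_set E) (pmf_of_set E))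
      {(x, y). \<exists>orb\<in>orbits G E \<phi>. x \<in> orb \<and> y \<in> orb}
    = real (order G) / real (card E) * ((\<Sum>x\<in>E. 1 / real (card (stabilizer G \<phi> x))) / real (card E))"
proof -
  have "card (orbit G \<phi> x) = real (order G) * (1 / real (card (stabilizer G \<phi> x)))"
    if "x \<in> E" for x
  proof -
    have "finite (stabilizer G \<phi> x)" using stabilizer_subset assms(3) finite_subset by blast
    with stabilizer_one_closed[OF that] have "card (stabilizer G \<phi> x) \<noteq> 0" by auto
    moreover have "real (card (orbit G \<phi> x)) * real (card (stabilizer G \<phi> x)) = real (order G)"
      using orbit_stabilizer_theorem[OF that] by (metis of_nat_mult)
    ultimately show ?thesis by (simp add: field_simps)
  qed
  moreover have "(E \<times> E) \<inter> {(x, y). \<exists>orb\<in>orbits G E \<phi>. x \<in> orb \<and> y \<in> orb}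
      = Sigma E (orbit G \<phi>)"
    using same_orbit_iff orbit_subset by auto
  moreover have "card (Sigma E (orbit G \<phi>)) = (\<Sum>x\<in>E. card (orbit G \<phi> x))"
    using assms orbit_subset finite_subset by (intro card_SigmaI) blast+
  ultimately show ?thesis
    using assms by (simp add: pair_pmf_of_set measure_pmf_of_set card_cartesian_product
        sum_distrib_left sum_divide_distrib mult_ac)
qed

text \<open>If \<open>k\<close> nonidentity elements fix \<open>x\<close>, the summand is 1 / (k +
  1), which lies between 1 - k and 1. Summing \<open>k\<close> over all \<open>x\<close> counts the
  pairs (g, x) with \<open>g\<close> nonidentity and \<open>x\<close> fixed by \<open>g\<close>;
  grouping them by \<open>g\<close> gives the sum of the sizes of the fixed-point sets.\<close>

lemma mean_inverse_card_stabilizer: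
  assumes "finite E" "E \<noteq> {}" "finite (carrier G)"
  defines "M \<equiv> (\<Sum>x\<in>E. 1 / real (card (stabilizer G \<phi> x))) / real (card E)"
  shows "M \<le> 1" "1 - (\<Sum>g\<in>carrier G - {\<one>}. real (card (invariants E \<phi> g))) / real (card E) \<le> M"
proof -
  define k where "k x = card {g \<in> carrier G - {\<one>}. \<phi> g x = x}" for x
  have k: "card (stabilizer G \<phi> x) = Suc (k x)" if "x \<in> E" for x
  proof -
    have "stabilizer G \<phi> x = insert \<one> {g \<in> carrier G - {\<one>}. \<phi> g x = x}"
      using stabilizer_one_closed[OF that] by (auto simp: stabilizer_def)
    then show ?thesis using assms by (simp add: k_def)
  qed
  have E: "real (card E) > 0" using assms by (simp add: card_gt_0_iff)
  have "(\<Sum>x\<in>E. 1 / real (card (stabilizer G \<phi> x))) \<le> (\<Sum>x\<in>E. 1)"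
    by (intro sum_mono) (simp add: k)
  then show "M \<le> 1" using E by (simp add: M_def)
  have "(\<Sum>x\<in>E. k x) = (\<Sum>g\<in>carrier G - {\<one>}. card (invariants E \<phi> g))"
    unfolding k_def invariants_def
    using assms by (intro sum_multicount_gen) auto
  then have "real (card E) - (\<Sum>g\<in>carrier G - {\<one>}. real (card (invariants E \<phi> g)))
      = (\<Sum>x\<in>E. 1 - real (k x))"
    by (simp add: sum_subtractf flip: of_nat_sum)
  also have "\<dots> \<le> (\<Sum>x\<in>E. 1 / real (card (stabilizer G \<phi> x)))"
    by (intro sum_mono) (simp add: k field_simps)
  finally show "1 - (\<Sum>g\<in>carrier G - {\<one>}. real (card (invariants E \<phi> g))) / real (card E) \<le> M"
    using E by (simp add: M_def field_simps)
qed

end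

section \<open>Sets moved off themselves, determined functions and fixed points of affine
  maps\<close>

text \<open>Take \<open>S\<close> maximal among the subsets disjoint from their image. Every moved
  point then lies in \<open>S\<close>, in its image or in its preimage, and by injectivity each of
  these has at most \<open>card S\<close> elements.\<close>

lemma large_subset_disjoint_from_image:
  assumes "finite X" "A ` X \<subseteq> X" "inj_on A X"
  obtains S where "S \<subseteq> X" "A ` S \<inter> S = {}" "card {x \<in> X. A x \<noteq> x} \<le> 3 * card S"
proof -
  define \<S> where "\<S> = {S. S \<subseteq> X \<and> A ` S \<inter> S = {}}"
  have "finite \<S>" "{} \<in> \<S>" using assms by (auto simp: \<S>_def)
  then have "\<exists>S\<in>\<S>. \<forall>T\<in>\<S>. S \<subseteq> T \<longrightarrow> S = T" by (intro finite_has_maximal) auto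
  then obtain S where "S \<in> \<S>" and max: "\<forall>T\<in>\<S>. S \<subseteq> T \<longrightarrow> S = T" by blast
  then have S: "S \<subseteq> X" "A ` S \<inter> S = {}" by (simp_all add: \<S>_def)
  have fS: "finite S" using S assms finite_subset by blast
  have "{x \<in> X. A x \<noteq> x} \<subseteq> S \<union> A ` S \<union> {x \<in> X. A x \<in> S}"
  proof
    fix x assume x: "x \<in> {x \<in> X. A x \<noteq> x}"
    show "x \<in> S \<union> A ` S \<union> {x \<in> X. A x \<in> S}"
    proof (rule ccontr)
      \<comment> \<open>A moved point outside all three sets could be added to \<open>S\<close>,
        against maximality.\<close>
      assume n: "x \<notin> S \<union> A ` S \<union> {x \<in> X. A x \<in> S}"
      then have "A x \<notin> insert x S" "x \<notin> A ` S" using x by auto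
      moreover have "A x \<noteq> x" using x by simp
      ultimately have "A ` insert x S \<inter> insert x S = {}" using S(2) by auto
      then have "insert x S \<in> \<S>" using x S(1) by (simp add: \<S>_def)
      with max have "S = insert x S" by blast
      with n show False by blast
    qed
  qed
  then have "card {x \<in> X. A x \<noteq> x} \<le> card (S \<union> A ` S \<union> {x \<in> X. A x \<in> S})"
    using fS assms by (intro card_mono) auto
  also have "\<dots> \<le> card S + card (A ` S) + card {x \<in> X. A x \<in> S}"
    by (meson card_Un_le le_trans add_le_mono order_refl)
  also have "card (A ` S) \<le> card S" using fS by (rule card_image_le)
  also have "card {x \<in> X. A x \<in> S} \<le> card S"
    using fS assms by (intro card_inj_on_le[of A]) (auto intro: inj_on_subset)
  finally show ?thesis using S by (intro that[of S]) auto
qed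

text \<open>Restriction to \<open>X - S\<close> is injective on \<open>T\<close>.\<close>

lemma card_funs_determined:
  assumes "finite X" "finite Y" "S \<subseteq> X" "T \<subseteq> X \<rightarrow>\<^sub>E Y"
    and "\<And>F F'. F \<in> T \<Longrightarrow> F' \<in> T \<Longrightarrow> (\<And>x. x \<in> X - S \<Longrightarrow> F x = F' x) \<Longrightarrow> F = F'"
  shows "card T \<le> card Y ^ (card X - card S)"
proof -
  have "card T \<le> card ((X - S) \<rightarrow>\<^sub>E Y)"
  proof (rule card_inj_on_le[where f = "\<lambda>F. restrict F (X - S)"])
    show "inj_on (\<lambda>F. restrict F (X - S)) T"
      using assms(5) by (intro inj_onI) (metis restrict_apply')
    show "(\<lambda>F. restrict F (X - S)) ` T \<subseteq> (X - S) \<rightarrow>\<^sub>E Y"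
      using assms(4) by (force simp: PiE_iff)
    show "finite ((X - S) \<rightarrow>\<^sub>E Y)" using assms by (intro finite_PiE) auto
  qed
  also have "\<dots> = card Y ^ (card X - card S)"
    using assms(1) card_Diff_subset[OF finite_subset[OF assms(3,1)] assms(3)]
    by (subst card_PiE) auto
  finally show ?thesis .
qed

text \<open>If the linear part moves some \<open>v\<close>, translation by \<open>v\<close> carries
  the fixed-point set to a disjoint copy of itself, and both copies fit into the space. If the
  linear part is the identity, the map is a translation by a nonzero vector and fixes
  nothing.\<close>

lemma card_affine_fixed_points:
  fixes P :: "'q :: {field, finite} mat"
  assumes P: "P \<in> carrier_mat k k" and a: "a \<in> carrier_vec k"
    and moved: "\<exists>x\<in>carrier_vec k. P *\<^sub>v x + a \<noteq> x"
  shows "2 * card {x \<in> carrier_vec k. P *\<^sub>v x + a = x} \<le> CARD('q) ^ k"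
proof (cases "\<exists>v\<in>carrier_vec k. P *\<^sub>v v \<noteq> v")
  case True
  then obtain v where v: "v \<in> carrier_vec k" "P *\<^sub>v v \<noteq> v" by blast
  let ?F = "{x \<in> carrier_vec k. P *\<^sub>v x + a = x}"
  have cancel: "x + v - v = x" if "x \<in> carrier_vec k" for x
    using that v by (intro eq_vecI) auto
  \<comment> \<open>If \<open>x\<close> and \<open>x + v\<close> were both fixed, subtracting the
    two equations would give \<open>P *\<^sub>v v = v\<close>.\<close>
  have shift: "x + v \<notin> ?F" if "x \<in> ?F" for x
  proof
    assume "x + v \<in> ?F"
    then have "P *\<^sub>v x + P *\<^sub>v v + a = x + v"
      using that P v by (simp add: mult_add_distrib_mat_vec[OF P])
    moreover have "P *\<^sub>v x + P *\<^sub>v v + a = P *\<^sub>v v + (P *\<^sub>v x + a)"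
    proof -
      have "u + w + a = w + (u + a)" if "u \<in> carrier_vec k" "w \<in> carrier_vec k" for u w
        using that a by (intro eq_vecI) auto
      then show ?thesis using that P v by simp
    qed
    ultimately have "P *\<^sub>v v + x = x + v" using that by simp
    moreover have "P *\<^sub>v v + x - x = P *\<^sub>v v" "x + v - x = v"
      using that P v by (auto intro!: eq_vecI)
    ultimately show False using v by simp
  qed
  have "card ((\<lambda>x. x + v) ` ?F) = card ?F"
    using cancel by (intro card_image inj_onI) (metis (mono_tags, lifting) mem_Collect_eq)
  moreover have "card (?F \<union> (\<lambda>x. x + v) ` ?F) = card ?F + card ((\<lambda>x. x + v) ` ?F)"
    using shift by (intro card_Un_disjoint) auto
  moreover have "card (?F \<union> (\<lambda>x. x + v) ` ?F) \<le> card (carrier_vec k :: 'q vec set)"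
    using v by (intro card_mono) auto
  ultimately show ?thesis by (simp add: card_carrier_vec)
next
  case False
  have "{x \<in> carrier_vec k. P *\<^sub>v x + a = x} = {}"
  proof safe
    fix x assume x: "x \<in> carrier_vec k" "P *\<^sub>v x + a = x"
    then have "x + a = x" using False by simp
    moreover have "x + a - x = a" "x - x = 0\<^sub>v k" using x a by (auto intro!: eq_vecI)
    ultimately have "a = 0\<^sub>v k" by simp
    with moved False show "x \<in> {}" by auto
  qed
  then show ?thesis by (simp only: card.empty)
qed

section \<open>Linear maps and the order of the EA group\<close>

lemma Lin_eqI:
  assumes L: "L \<in> Lin n m" "L' \<in> Lin n m"
    and eq: "\<And>i. i < n \<Longrightarrow> L (unit_vec n i) = L' (unit_vec n i)"
  shows "L = L'"
proof (rule extensionalityI)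
  show "L \<in> extensional (carrier_vec n)" "L' \<in> extensional (carrier_vec n)"
    using L by (auto simp: Lin_def vec_funs_def PiE_def)
  \<comment> \<open>Induction on a bound \<open>k\<close> for the support: only the first
    \<open>k\<close> coordinates may be nonzero, and each step splits off the last of them. For
    \<open>k = n\<close> the support condition is vacuous.\<close>
  have "L x = L' x" if "x \<in> carrier_vec n" "k \<le> n" "\<And>i. k \<le> i \<Longrightarrow> i < n \<Longrightarrow> x $ i = 0" for k x
    using that
  proof (induction k arbitrary: x)
    case 0
    then have "x = 0\<^sub>v n" by (intro eq_vecI) auto
    then show ?case using LinD(4)[OF L(1) 0(1)] LinD(4)[OF L(2) 0(1)] by simp
  next
    case (Suc k)
    define y where "y = vec n (\<lambda>i. if i = k then 0 else x $ i)"
    have y: "y \<in> carrier_vec n" by (simp add: y_def)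
    have "L y = L' y" using Suc by (intro Suc.IH) (auto simp: y_def)
    moreover have x: "x = y + x $ k \<cdot>\<^sub>v unit_vec n k"
      using Suc by (intro eq_vecI) (auto simp: y_def)
    moreover have "K (y + x $ k \<cdot>\<^sub>v unit_vec n k) = K y + x $ k \<cdot>\<^sub>v K (unit_vec n k)"
      if "K \<in> Lin n m" for K
      using LinD(2)[OF that y] LinD(3)[OF that unit_vec_carrier] by simp
    ultimately show ?case using L eq[of k] Suc.prems(2) by (metis Suc_le_lessD)
  qed
  from this[of _ n] show "L x = L' x" if "x \<in> carrier_vec n" for x using that by simp
qed

lemma card_vec_funs:
  "card (vec_funs n m :: ('q :: {field, finite} vec \<Rightarrow> 'q vec) set) = (CARD('q) ^ m) ^ (CARD('q) ^ n)"
  by (simp add: vec_funs_def card_PiE card_carrier_vec)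

lemma finite_vec_funs: "finite (vec_funs n m :: ('q :: {field, finite} vec \<Rightarrow> 'q vec) set)"
  unfolding vec_funs_def by (intro finite_PiE) auto

lemma finite_Lin: "finite (Lin n m :: ('q :: {field, finite} vec \<Rightarrow> 'q vec) set)"
  by (rule finite_subset[OF _ finite_vec_funs]) (auto simp: Lin_def)

text \<open>A linear map is determined by its values at the \<open>n\<close> unit vectors, each
  value being one of q^m vectors.\<close>

lemma card_Lin_le:
  "card (Lin n m :: ('q :: {field, finite} vec \<Rightarrow> 'q vec) set) \<le> CARD('q) ^ (n * m)"
proof -
  have "card (Lin n m :: ('q vec \<Rightarrow> 'q vec) set) \<le> card ({..<n} \<rightarrow>\<^sub>E (carrier_vec m :: 'q vec set))"
  proof (rule card_inj_on_le[where f = "\<lambda>L. \<lambda>i\<in>{..<n}. L (unit_vec n i)"])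
    show "inj_on (\<lambda>L. \<lambda>i\<in>{..<n}. L (unit_vec n i)) (Lin n m :: ('q vec \<Rightarrow> 'q vec) set)"
      by (intro inj_onI Lin_eqI) (auto dest!: fun_cong split: if_splits)
    show "finite ({..<n} \<rightarrow>\<^sub>E (carrier_vec m :: 'q vec set))" by (intro finite_PiE) auto
    show "(\<lambda>L. \<lambda>i\<in>{..<n}. L (unit_vec n i)) ` Lin n m \<subseteq> {..<n} \<rightarrow>\<^sub>E (carrier_vec m :: 'q vec set)"
      using LinD(1)[OF _ unit_vec_carrier] by (intro image_subsetI restrict_PiE_iff[THEN iffD2] ballI)
  qed
  also have "\<dots> = CARD('q) ^ (n * m)"
    by (simp add: card_PiE card_carrier_vec mult.commute flip: power_mult)
  finally show ?thesis .
qed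

text \<open>Replacing the matrix by the linear map it induces reduces the count to
  \<open>Lin k k\<close> and the translations.\<close>

lemma AGL_subset:
  "AGL k \<subseteq> (\<lambda>(M, a). \<lambda>x\<in>carrier_vec k. M x + a) ` (Lin k k \<times> carrier_vec k)"
proof
  fix f :: "'a vec \<Rightarrow> 'a vec" assume "f \<in> AGL k"
  then obtain P a where f: "f = affine_map k P a" "P \<in> GL k" "a \<in> carrier_vec k"
    by (auto simp: AGL_def)
  define M where "M = (\<lambda>x\<in>carrier_vec k. P *\<^sub>v x)"
  note P = GL_carrier[OF f(2)]
  have "M \<in> Lin k k"
    using P by (auto simp: M_def Lin_def vec_funs_def
        mult_add_distrib_mat_vec[OF P] mult_mat_vec[OF P])
  moreover have "f = (\<lambda>x\<in>carrier_vec k. M x + a)"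
    by (auto simp: f affine_map_def M_def)
  ultimately show "f \<in> (\<lambda>(M, a). \<lambda>x\<in>carrier_vec k. M x + a) ` (Lin k k \<times> carrier_vec k)"
    using f by (intro image_eqI[of _ _ "(M, a)"]) auto
qed

lemma finite_AGL: "finite (AGL k :: ('q :: {field, finite} vec \<Rightarrow> 'q vec) set)"
  by (intro finite_subset[OF AGL_subset] finite_imageI finite_cartesian_product finite_Lin
      finite_carrier_vec)

lemma card_AGL_le:
  "card (AGL k :: ('q :: {field, finite} vec \<Rightarrow> 'q vec) set) \<le> CARD('q) ^ (k * k + k)"
proof -
  have "card (AGL k :: ('q vec \<Rightarrow> 'q vec) set)
    \<le> card (Lin k k \<times> carrier_vec k :: (('q vec \<Rightarrow> 'q vec) \<times> 'q vec) set)"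
    by (intro surj_card_le[OF _ AGL_subset] finite_cartesian_product finite_Lin finite_carrier_vec)
  also have "\<dots> \<le> CARD('q) ^ (k * k) * CARD('q) ^ k"
    by (simp add: card_cartesian_product card_carrier_vec card_Lin_le)
  finally show ?thesis by (simp add: power_add)
qed

lemma finite_EA_group: "finite (carrier (EA_group n m :: 'q :: {field, finite} ea monoid))"
  by (simp add: EA_group_def finite_AGL finite_Lin)

lemma card_EA_group_le:
  "card (carrier (EA_group n m :: 'q :: {field, finite} ea monoid))
    \<le> CARD('q) ^ (n * n + n + (m * m + m) + n * m)"
proof -
  have "card (carrier (EA_group n m :: 'q ea monoid))
    \<le> CARD('q) ^ (n * n + n) * (CARD('q) ^ (m * m + m) * CARD('q) ^ (n * m))"
    unfolding EA_group_def partial_object.simps card_cartesian_product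
    by (intro mult_le_mono card_AGL_le card_Lin_le)
  then show ?thesis by (simp add: power_add mult.assoc)
qed

section \<open>Functions fixed by a nonidentity group element\<close>

lemma affine_map_inj_on:
  assumes "P \<in> GL k" "a \<in> carrier_vec k"
  shows "inj_on (\<lambda>x. P *\<^sub>v x + a) (carrier_vec k)"
proof (rule inj_onI)
  obtain P' where P': "P' \<in> GL k" "P' * P = 1\<^sub>m k" using GL_inverse assms(1) .
  note c = GL_carrier[OF assms(1)] GL_carrier[OF P'(1)]
  fix x y assume xy: "x \<in> carrier_vec k" "y \<in> carrier_vec k" "P *\<^sub>v x + a = P *\<^sub>v y + a"
  have "P *\<^sub>v z + a - a = P *\<^sub>v z" if "z \<in> carrier_vec k" for z
    using that c assms by (intro eq_vecI) auto
  then have "P *\<^sub>v x = P *\<^sub>v y" using xy by metis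
  moreover have "P' *\<^sub>v (P *\<^sub>v z) = z" if "z \<in> carrier_vec k" for z
    using assoc_mult_mat_vec[OF c(2,1) that] P' that by simp
  ultimately show "x = y" using xy by metis
qed

lemma card_field_ge_2: "CARD('q :: {field, finite}) \<ge> 2"
  using card_mono[of "UNIV :: 'q set" "{0, 1}"] by simp

lemma vec_add_eq_left_iff:
  fixes x y :: "'q :: field vec"
  assumes "x \<in> carrier_vec k" "y \<in> carrier_vec k"
  shows "x + y = x \<longleftrightarrow> y = 0\<^sub>v k"
  using assms by (auto simp: vec_eq_iff)

text \<open>Both cases yield an \<open>s\<close> with q^n \<le> 6 s such that being fixed costs a
  factor of at least 2^s: \<open>s\<close> is \<open>card S\<close> if the inner map moves a point,
  and q^n if it is the identity.\<close>

lemma card_invariants_ea_act: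
  fixes g :: "'q :: {field, finite} ea"
  assumes "m \<ge> 1" "g \<in> carrier (EA_group n m)" "g \<noteq> \<one>\<^bsub>EA_group n m\<^esub>"
  shows "2 ^ (CARD('q) ^ n div 6) * card (invariants (vec_funs n m) (ea_act n m) g)
    \<le> card (vec_funs n m :: ('q vec \<Rightarrow> 'q vec) set)"
proof -
  let ?q = "CARD('q)"
  obtain P a Q b L where g: "g = (affine_map n P a, affine_map m Q b, L)"
    "P \<in> GL n" "P \<in> carrier_mat n n" "a \<in> carrier_vec n"
    "Q \<in> GL m" "Q \<in> carrier_mat m m" "b \<in> carrier_vec m" "L \<in> Lin n m"
    using assms(2) by (elim EA_carrierE)
  define T where "T = invariants (vec_funs n m) (ea_act n m) g"
  have T_sub: "T \<subseteq> carrier_vec n \<rightarrow>\<^sub>E carrier_vec m" by (auto simp: T_def invariants_def vec_funs_def)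
  have Px: "P *\<^sub>v x + a \<in> carrier_vec n" if "x \<in> carrier_vec n" for x using g that by auto
  have T: "F x = Q *\<^sub>v F (P *\<^sub>v x + a) + b + L x" if "F \<in> T" "x \<in> carrier_vec n" for F x
  proof -
    have "F \<in> vec_funs n m" "ea_act n m g F x = F x"
      using that by (auto simp: T_def invariants_def)
    moreover from this(1) have "F (P *\<^sub>v x + a) \<in> carrier_vec m"
      using Px that by (auto simp: vec_funs_def)
    ultimately show ?thesis using that Px by (simp add: ea_act_def g(1) affine_map_def)
  qed
  have "\<exists>s. ?q ^ n \<le> 6 * s \<and> 2 ^ s * card T \<le> (?q ^ m) ^ (?q ^ n)"
  proof (cases "\<exists>x\<in>carrier_vec n. P *\<^sub>v x + a \<noteq> x")
    case True
    let ?X = "carrier_vec n :: 'q vec set"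
    have "(\<lambda>x. P *\<^sub>v x + a) ` ?X \<subseteq> ?X" using Px by blast
    from large_subset_disjoint_from_image[OF finite_carrier_vec this affine_map_inj_on[OF g(2,4)]]
    obtain S where S: "S \<subseteq> ?X" "(\<lambda>x. P *\<^sub>v x + a) ` S \<inter> S = {}"
      "card {x \<in> ?X. P *\<^sub>v x + a \<noteq> x} \<le> 3 * card S" .
    have "card ?X = card {x \<in> ?X. P *\<^sub>v x + a = x} + card {x \<in> ?X. P *\<^sub>v x + a \<noteq> x}"
      by (subst card_Un_disjoint[symmetric]) (auto intro!: arg_cong[of _ _ card])
    \<comment> \<open>The constant is 2 * 3: at least half of the points are moved, and
      \<open>S\<close> has at least a third as many elements as there are moved points.\<close>
    then have "?q ^ n \<le> 6 * card S"
      using card_affine_fixed_points[OF g(3,4) True] S(3) by (simp add: card_carrier_vec)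
    moreover have S_le: "card S \<le> ?q ^ n"
      using card_mono[OF _ S(1)] by (simp add: card_carrier_vec)
    have "card T \<le> (?q ^ m) ^ (?q ^ n - card S)"
      unfolding card_carrier_vec[symmetric, where 'b = 'q]
    proof (rule card_funs_determined[OF _ _ S(1) T_sub])
      fix F F' assume F: "F \<in> T" "F' \<in> T" "\<And>x. x \<in> ?X - S \<Longrightarrow> F x = F' x"
      have "F x = F' x" if x: "x \<in> ?X" for x
      proof (cases "x \<in> S")
        case True
        \<comment> \<open>The fixed-point equation expresses \<open>F x\<close> through the value at
          a point outside \<open>S\<close>.\<close>
        then have "P *\<^sub>v x + a \<in> ?X - S" using S Px[OF x] by blast
        then show ?thesis using T[OF F(1) x] T[OF F(2) x] F(3) by simp
      qed (use F x in auto)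
      then show "F = F'" using F T_sub by (intro PiE_ext[where k = ?X]) auto
    qed auto
    \<comment> \<open>Each determined point saves a factor q^m, which is at least 2 because
      \<open>m \<ge> 1\<close>.\<close>
    then have "2 ^ card S * card T \<le> (?q ^ m) ^ card S * (?q ^ m) ^ (?q ^ n - card S)"
    proof (intro mult_le_mono power_mono)
      show "2 \<le> ?q ^ m"
        using self_le_power[of ?q m] card_field_ge_2[where 'q = 'q] assms(1) by simp
    qed auto
    then have "2 ^ card S * card T \<le> (?q ^ m) ^ (?q ^ n)"
      using S_le by (simp flip: power_add)
    ultimately show ?thesis by blast
  next
    case False
    then have id: "P *\<^sub>v x + a = x" if "x \<in> carrier_vec n" for x using that by blast
    have L: "L x \<in> carrier_vec m" if "x \<in> carrier_vec n" for x using LinD(1)[OF g(8) that] .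
    \<comment> \<open>With the identity as inner map, the condition decouples into one fixed-point
      equation for each value \<open>F x\<close>.\<close>
    have "T \<subseteq> Pi\<^sub>E (carrier_vec n) (\<lambda>x. {y \<in> carrier_vec m. Q *\<^sub>v y + (b + L x) = y})"
    proof (intro subsetI PiE_I)
      fix F and x :: "'q vec" assume F: "F \<in> T" and x: "x \<in> carrier_vec n"
      have Fx: "F x \<in> carrier_vec m" using F T_sub x by auto
      have "Q *\<^sub>v F x + (b + L x) = Q *\<^sub>v F x + b + L x"
        using g Fx L[OF x] by (intro assoc_add_vec[symmetric]) auto
      also have "\<dots> = F x"
        using T[OF F x, symmetric] unfolding id[OF x] .
      finally show "F x \<in> {y \<in> carrier_vec m. Q *\<^sub>v y + (b + L x) = y}"
        using Fx by simp
    next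
      fix F and x :: "'q vec" assume "F \<in> T" "x \<notin> carrier_vec n"
      then show "F x = undefined" using PiE_arb[OF subsetD[OF T_sub]] by blast
    qed
    then have "card T \<le> card (Pi\<^sub>E (carrier_vec n) (\<lambda>x. {y \<in> carrier_vec m. Q *\<^sub>v y + (b + L x) = y}))"
      by (intro card_mono finite_PiE) auto
    also have "\<dots> = (\<Prod>x\<in>carrier_vec n. card {y \<in> carrier_vec m. Q *\<^sub>v y + (b + L x) = y})"
      by (rule card_PiE) auto
    finally have le: "2 ^ (?q ^ n) * card T
        \<le> (\<Prod>x\<in>(carrier_vec n :: 'q vec set). 2 * card {y \<in> carrier_vec m. Q *\<^sub>v y + (b + L x) = y})"
      by (simp add: prod.distrib card_carrier_vec)
    \<comment> \<open>If the affine map at one \<open>x\<close> were the identity, then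
      \<open>Q\<close> would act as the identity, and any \<open>F\<close> in \<open>T\<close> would
      force \<open>b + L z\<close> to vanish for every \<open>z\<close>. Taking \<open>z = 0\<close>
      gives b = 0, hence L = 0, so \<open>g\<close> would be the identity of the group. An empty
      \<open>T\<close> satisfies the final bound trivially.\<close>
    have "2 * card {y \<in> carrier_vec m. Q *\<^sub>v y + (b + L x) = y} \<le> ?q ^ m"
      if ne: "T \<noteq> {}" and x: "x \<in> carrier_vec n" for x
    proof (rule card_affine_fixed_points[OF g(6)])
      show "b + L x \<in> carrier_vec m" using g L x by auto
      show "\<exists>y\<in>carrier_vec m. Q *\<^sub>v y + (b + L x) \<noteq> y"
      proof (rule ccontr)
        assume "\<not> (\<exists>y\<in>carrier_vec m. Q *\<^sub>v y + (b + L x) \<noteq> y)"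
        then have all: "Q *\<^sub>v y + (b + L x) = y" if "y \<in> carrier_vec m" for y using that by blast
        have "Q *\<^sub>v 0\<^sub>v m = 0\<^sub>v m" using g(6) by (intro eq_vecI) auto
        then have "b + L x = 0\<^sub>v m" using all[of "0\<^sub>v m"] g(7) L[OF x] by simp
        then have Q: "Q *\<^sub>v y = y" if "y \<in> carrier_vec m" for y
          using all[OF that] g(6) that by simp
        obtain F where F: "F \<in> T" using ne by blast
        have bL: "b + L z = 0\<^sub>v m" if z: "z \<in> carrier_vec n" for z
        proof -
          have Fz: "F z \<in> carrier_vec m" using F T_sub z by auto
          have "F z + b + L z = F z"
            using T[OF F z, symmetric] unfolding id[OF z] Q[OF Fz] .
          then have "F z + (b + L z) = F z" using Fz g(7) L[OF z] by (metis assoc_add_vec)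
          then show ?thesis using Fz g(7) L[OF z] by (simp add: vec_add_eq_left_iff)
        qed
        have b: "b = 0\<^sub>v m" using bL[of "0\<^sub>v n"] LinD(4)[OF g(8) zero_carrier_vec] g(7) by simp
        have "L = (\<lambda>x\<in>carrier_vec n. 0\<^sub>v m)"
          using g(8) bL L b
          by (intro extensionalityI[where A = "carrier_vec n"]) (auto simp: Lin_def vec_funs_def PiE_def)
        moreover have "affine_map n P a = affine_map n (1\<^sub>m n) (0\<^sub>v n)"
          "affine_map m Q b = affine_map m (1\<^sub>m m) (0\<^sub>v m)"
          using id Q b by (auto simp: affine_map_def intro!: restrict_ext)
        ultimately show False using assms(3) g(1) by simp
      qed
    qed
    then have "(\<Prod>x\<in>(carrier_vec n :: 'q vec set). 2 * card {y \<in> carrier_vec m. Q *\<^sub>v y + (b + L x) = y})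
        \<le> (?q ^ m) ^ (?q ^ n)" if "T \<noteq> {}"
      using that prod_mono[of "carrier_vec n :: 'q vec set"
          "\<lambda>x. 2 * card {y \<in> carrier_vec m. Q *\<^sub>v y + (b + L x) = y}" "\<lambda>_. ?q ^ m"]
      by (simp add: card_carrier_vec)
    with le show ?thesis by (cases "T = {}") (auto intro!: exI[of _ "?q ^ n"])
  qed
  then obtain s where s: "?q ^ n \<le> 6 * s" "2 ^ s * card T \<le> (?q ^ m) ^ (?q ^ n)" by blast
  have "?q ^ n div 6 \<le> s" using s(1) by simp
  then have "2 ^ (?q ^ n div 6) * card T \<le> 2 ^ s * card T"
    by (intro mult_le_mono power_increasing) auto
  also note s(2)
  finally show ?thesis by (simp only: T_def card_vec_funs)
qed

section \<open>Asymptotics and the limit of the mean\<close>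

lemma exp_quadratic_over_double_exp_tendsto_0:
  fixes q :: nat
  assumes "q \<ge> 2"
  shows "(\<lambda>n. real (q ^ (n * n + n + (m * m + m) + n * m)) / 2 ^ (q ^ n div 6)) \<longlonglongrightarrow> 0"
proof -
  define c where "c = ln (real q)"
  have c: "c > 0" using assms by (simp add: c_def)
  define K where "K = real m"
  have lim: "(\<lambda>n::nat. exp (c * (real n * real n + real n + (K * K + K) + real n * K)
      + ln 2 * (1 - exp (c * real n) / 6))) \<longlonglongrightarrow> 0"
    using c by real_asymp
  show ?thesis
  proof (rule tendsto_sandwich[OF _ _ tendsto_const lim])
    show "\<forall>\<^sub>F n in sequentially. real (q ^ (n * n + n + (m * m + m) + n * m)) / 2 ^ (q ^ n div 6)
      \<le> exp (c * (real n * real n + real n + (K * K + K) + real n * K) + ln 2 * (1 - exp (c * real n) / 6))"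
    proof (intro always_eventually allI)
      fix n
      have pow: "real (q ^ j) = exp (c * real j)" for j
        using assms by (simp add: c_def exp_of_nat2_mult)
      \<comment> \<open>Rounding in \<open>div\<close> loses at most 1 in the exponent of 2, which
        is the 1 in the term \<open>1 - exp (c * real n) / 6\<close>.\<close>
      have "q ^ n \<le> 6 * (q ^ n div 6) + 6" by presburger
      then have "real (q ^ n) / 6 - 1 \<le> real (q ^ n div 6)" by linarith
      then have "ln 2 * (real (q ^ n) / 6 - 1) \<le> ln 2 * real (q ^ n div 6)"
        by (intro mult_left_mono) auto
      moreover have "(2 :: real) ^ (q ^ n div 6) = exp (ln 2 * real (q ^ n div 6))"
        by (simp add: exp_of_nat2_mult)
      ultimately show "real (q ^ (n * n + n + (m * m + m) + n * m)) / 2 ^ (q ^ n div 6)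
        \<le> exp (c * (real n * real n + real n + (K * K + K) + real n * K) + ln 2 * (1 - exp (c * real n) / 6))"
        unfolding pow by (simp add: K_def algebra_simps flip: exp_diff)
    qed
  qed auto
qed

text \<open>The product formula is exact for every \<open>n\<close> with the mean inverse stabilizer
  order \<open>M n\<close> as second factor, so the relative error is \<open>M n - 1\<close>. It
  tends to 0 because \<open>M n\<close> is squeezed between \<open>1 - B n\<close> and 1.\<close>

theorem corollary3p9:
  fixes m :: nat
  assumes "m \<ge> 1"
  shows "\<exists>\<epsilon> :: nat \<Rightarrow> real. \<epsilon> \<in> o[at_top](\<lambda>_. 1) \<and>
    (\<forall>n\<ge>1.
      measure_pmf.prob
        (pair_pmf (pmf_of_set (vec_funs n m)) (pmf_of_set (vec_funs n m)))
        {(F, G :: 'q :: {field, finite} vec \<Rightarrow> 'q vec). EA_equivalent n m F G}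
      = real (card (carrier (EA_group n m :: 'q ea monoid)))
          / real (card (vec_funs n m :: ('q vec \<Rightarrow> 'q vec) set)) * (1 + \<epsilon> n))"
proof -
  define M where "M n = (\<Sum>F\<in>(vec_funs n m :: ('q vec \<Rightarrow> 'q vec) set).
      1 / real (card (stabilizer (EA_group n m) (ea_act n m) F)))
    / real (card (vec_funs n m :: ('q vec \<Rightarrow> 'q vec) set))" for n
  define B where "B n = real (CARD('q) ^ (n * n + n + (m * m + m) + n * m)) / 2 ^ (CARD('q) ^ n div 6)" for n
  have ne: "(vec_funs n m :: ('q vec \<Rightarrow> 'q vec) set) \<noteq> {}" for n
    using card_vec_funs[of n m, where 'q = 'q]
    by (metis card.empty power_eq_0_iff zero_less_card_finite less_irrefl)
  have prob: "measure_pmf.prob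
        (pair_pmf (pmf_of_set (vec_funs n m)) (pmf_of_set (vec_funs n m)))
        {(F, G :: 'q vec \<Rightarrow> 'q vec). EA_equivalent n m F G}
      = real (card (carrier (EA_group n m :: 'q ea monoid)))
          / real (card (vec_funs n m :: ('q vec \<Rightarrow> 'q vec) set)) * M n" for n
    using group_action.prob_same_orbit[OF group_action_ea_act finite_vec_funs ne finite_EA_group]
    unfolding EA_equivalent_def M_def order_def .
  have M: "M n \<le> 1" "1 - B n \<le> M n" for n
  proof -
    let ?E = "vec_funs n m :: ('q vec \<Rightarrow> 'q vec) set"
    let ?G = "EA_group n m :: 'q ea monoid"
    note mean = group_action.mean_inverse_card_stabilizer
      [OF group_action_ea_act finite_vec_funs ne[of n] finite_EA_group, folded M_def]
    show "M n \<le> 1" by (rule mean(1))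
    have E: "real (card ?E) > 0" using ne finite_vec_funs by (simp add: card_gt_0_iff)
    \<comment> \<open>Every nonidentity element fixes at most the fraction 1 / 2^(q^n div 6) of all
      functions; multiplied by the bound on the group order this gives \<open>B n\<close>.\<close>
    have "(\<Sum>g\<in>carrier ?G - {\<one>\<^bsub>?G\<^esub>}. real (card (invariants ?E (ea_act n m) g)))
      \<le> (\<Sum>g\<in>carrier ?G - {\<one>\<^bsub>?G\<^esub>}. real (card ?E) / 2 ^ (CARD('q) ^ n div 6))"
    proof (intro sum_mono)
      fix g assume "g \<in> carrier ?G - {\<one>\<^bsub>?G\<^esub>}"
      then have "real (2 ^ (CARD('q) ^ n div 6) * card (invariants ?E (ea_act n m) g)) \<le> real (card ?E)"
        using card_invariants_ea_act[OF assms, of g n] unfolding of_nat_le_iff by blast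
      then show "real (card (invariants ?E (ea_act n m) g)) \<le> real (card ?E) / 2 ^ (CARD('q) ^ n div 6)"
        by (simp add: field_simps)
    qed
    also have "\<dots> = real (card (carrier ?G - {\<one>\<^bsub>?G\<^esub>})) * (real (card ?E) / 2 ^ (CARD('q) ^ n div 6))"
      by simp
    also have "\<dots> \<le> real (CARD('q) ^ (n * n + n + (m * m + m) + n * m)) * (real (card ?E) / 2 ^ (CARD('q) ^ n div 6))"
      using card_mono[OF finite_EA_group, of "carrier ?G - {\<one>\<^bsub>?G\<^esub>}"]
        card_EA_group_le[of n m, where 'q = 'q]
      by (intro mult_right_mono) (auto intro: le_trans simp del: of_nat_power)
    also have "\<dots> = B n * real (card ?E)" by (simp add: B_def)
    finally have "(\<Sum>g\<in>carrier ?G - {\<one>\<^bsub>?G\<^esub>}. real (card (invariants ?E (ea_act n m) g))) / real (card ?E) \<le> B n"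
      using E by (simp add: field_simps)
    with mean(2) show "1 - B n \<le> M n" by linarith
  qed
  have "B \<longlonglongrightarrow> 0"
    unfolding B_def by (rule exp_quadratic_over_double_exp_tendsto_0[OF card_field_ge_2])
  then have "(\<lambda>n. 1 - B n) \<longlonglongrightarrow> 1" by (auto intro!: tendsto_eq_intros)
  then have "M \<longlonglongrightarrow> 1" using M by (intro tendsto_sandwich[of "\<lambda>n. 1 - B n" M _ "\<lambda>_. 1"]) auto
  then have "(\<lambda>n. M n - 1) \<longlonglongrightarrow> 0" by (auto intro!: tendsto_eq_intros)
  then have "(\<lambda>n. M n - 1) \<in> o[at_top](\<lambda>_. 1)" by (intro smalloI_tendsto) auto
  then show ?thesis using prob by (intro exI[of _ "\<lambda>n. M n - 1"]) auto
qed

end
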